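(* Let $(X,f)$ be an instance of a $p$-objective optimization problem and let $\varepsilon>0$. Consider a monotonic relation $R'$ defined on $X\times X$ and let $R := \{(x,x')\in X\times X : x\preceq_\varepsilon x' \text{ and } x R' x'\}$ be the intersection of the $(1+\varepsilon)$-dominance relation $\preceq_\varepsilon$ with $R'$. If there exists a constant $c$ (independent of the instance size and of $\frac1\varepsilon$) such that every nonempty subset $X'\subseteq X$ admits an $R'$-dominating set $P_{X'}\subseteq X'$ of cardinality at most $c$, then there exists an $R$-approximation set for $(X,f)$ of cardinality $\mathcal{O}\bigl(\bigl(\frac{M}{\varepsilon}\bigr)^{p-1}\bigr)$.
   Context: An instance $(X,f)$ of a $p$-objective optimization problem consists of a (finite or infinite) set $X$ of feasible solutions and a vector $f=(f_1,\dots,f_p)$ of polynomial-time computable objective functions $f_i:X\to\mathbb{Q}_{>0}$, all to be minimized; the number $p$ of objectives is a constant. Standing assumption: for each instance there is a constant $M$, bounded by a polynomial (depending only on the problem) in the encoding length of the instance, such that the binary encoding length of $f_i(x)$ is at most $M$ for all $x\in X$ and all $i\in\{1,\dots,p\}$. In particular, $2^{-M}\le f_i(x)\le 2^{M}$, and any two distinct values of $f_i$ differ by at least $2^{-2M}$. $(1+\varepsilon)$-dominance: $x\preceq_\varepsilon x'$ if and only if $f_i(x)\le(1+\varepsilon)\cdot f_i(x')$ for all $i=1,\dots,p$. A relation $S\subseteq X\times X$ is monotonic if $f_i(x)\le f_i(x')$ for all $i\in\{1,\dots,p\}$ implies $x S x'$. For a relation $S$ on $X$ and a subset $X'\subseteq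 X$, an $S$-dominating set for $X'$ is a subset $P\subseteq X'$ such that every $x'\in X'\setminus P$ satisfies $x S x'$ for some $x\in P$. An $S$-approximation set for $(X,f)$ is a set $P\subseteq X$ such that for every $x'\in X$ there is $x\in P$ with $x S x'$. *)

theory Defs
  imports
    "HOL-Library.Log_Nat"
    "HOL-Library.Landau_Symbols"
    "HOL-Computational_Algebra.Polynomial"
begin

text \<open>Numerator and denominator of the reduced fraction are both written in binary.\<close>

definition rat_encoding_length :: "rat \<Rightarrow> nat" where
  "rat_encoding_length q =
     nat (bitlen \<bar>fst (quotient_of q)\<bar>) + nat (bitlen (snd (quotient_of q)))"

text \<open>
  A \<open>p\<close>-objective minimization problem is a family of instances \<open>I \<in> Inst\<close> of encoding length
  \<open>len I\<close>, with feasible set \<open>X I\<close>, objective functions \<open>f I 1, \<dots>, f I p\<close> (values of \<open>f I\<close> at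
  other indices are irrelevant) and the bound \<open>M I\<close> on the encoding lengths of objective values.
  The objective functions are not required to be computable in polynomial time.
\<close>

locale multiobjective_problem =
  fixes p :: nat
    and Inst :: "'i set"
    and len :: "'i \<Rightarrow> nat"
    and X :: "'i \<Rightarrow> 'x set"
    and f :: "'i \<Rightarrow> nat \<Rightarrow> 'x \<Rightarrow> rat"
    and M :: "'i \<Rightarrow> nat"
  assumes p_pos: "p \<ge> 1"
    and objective_pos: "\<lbrakk>I \<in> Inst; i \<in> {1..p}; x \<in> X I\<rbrakk> \<Longrightarrow> f I i x > 0"
    and objective_length:
      "\<lbrakk>I \<in> Inst; i \<in> {1..p}; x \<in> X I\<rbrakk> \<Longrightarrow> rat_encoding_length (f I i x) \<le> M I"
    and bound_polynomial: "\<exists>q :: nat poly. \<forall>I\<in>Inst. M I \<le> poly q (len I)"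

definition eps_dominates :: "nat \<Rightarrow> (nat \<Rightarrow> 'x \<Rightarrow> rat) \<Rightarrow> real \<Rightarrow> 'x \<Rightarrow> 'x \<Rightarrow> bool" where
  "eps_dominates p f \<epsilon> x x' \<longleftrightarrow>
     (\<forall>i\<in>{1..p}. real_of_rat (f i x) \<le> (1 + \<epsilon>) * real_of_rat (f i x'))"

definition monotonic_relation ::
    "nat \<Rightarrow> 'x set \<Rightarrow> (nat \<Rightarrow> 'x \<Rightarrow> rat) \<Rightarrow> ('x \<times> 'x) set \<Rightarrow> bool" where
  "monotonic_relation p X f S \<longleftrightarrow>
     S \<subseteq> X \<times> X \<and> (\<forall>x\<in>X. \<forall>x'\<in>X. (\<forall>i\<in>{1..p}. f i x \<le> f i x') \<longrightarrow> (x, x') \<in> S)"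

definition dominating_set :: "('x \<times> 'x) set \<Rightarrow> 'x set \<Rightarrow> 'x set \<Rightarrow> bool" where
  "dominating_set S X' P \<longleftrightarrow> P \<subseteq> X' \<and> (\<forall>x'\<in>X' - P. \<exists>x\<in>P. (x, x') \<in> S)"

definition approximation_set :: "('x \<times> 'x) set \<Rightarrow> 'x set \<Rightarrow> 'x set \<Rightarrow> bool" where
  "approximation_set S X P \<longleftrightarrow> P \<subseteq> X \<and> (\<forall>x'\<in>X. \<exists>x\<in>P. (x, x') \<in> S)"

text \<open>
  The class \<open>\<O>((M/\<epsilon>)\<^sup>p\<^sup>-\<^sup>1)\<close> in the two variables \<open>M\<close> and \<open>\<epsilon>\<close>. The estimate is required for all
  \<open>M\<close> and uniformly on every bounded range \<open>0 < \<epsilon> \<le> E\<close>. It cannot be required uniformly in all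
  \<open>\<epsilon> > 0\<close>: for \<open>p \<ge> 2\<close> the bound tends to \<open>0\<close> as \<open>\<epsilon> \<rightarrow> \<infinity>\<close>, while an approximation set for a
  nonempty feasible set is nonempty.
\<close>

definition O_M_over_eps :: "nat \<Rightarrow> (nat \<times> real \<Rightarrow> real) set" where
  "O_M_over_eps k =
     (\<Inter>E\<in>{0<..}. O[principal (UNIV \<times> {0<..E})](\<lambda>(m, \<epsilon>). (real m / \<epsilon>) ^ k))"

end

theory Submission
  imports Defs "HOL-Library.FuncSet"
begin

text \<open>
  Round each objective value down to a power of \<open>1 + \<epsilon>\<close>, and group the resulting cells of the
  \<open>p\<close>-dimensional grid by their diagonals, the lines in direction \<open>(1, \<dots>, 1)\<close>. Every point of the
  first nonempty cell of a diagonal is componentwise at most every point of the later cells, so it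
  is related to them by monotonicity. Inside that first cell, any two points dominate each other up
  to \<open>1 + \<epsilon>\<close>, so an \<open>R'\<close>-dominating set of the cell suffices. Hence \<open>c\<close> points per diagonal are
  enough, and there are only \<open>\<O>((M/\<epsilon>)\<^sup>p\<^sup>-\<^sup>1)\<close> diagonals.
\<close>

section \<open>Covering an integer grid by its diagonals\<close>

lemma diagonal_approximation_set:
  fixes k :: "nat \<Rightarrow> 'x \<Rightarrow> int" and N c p :: nat and B :: int
  assumes p: "p \<ge> 1"
    and width: "\<And>x i. \<lbrakk>x \<in> X; i \<in> {1..p}\<rbrakk> \<Longrightarrow> \<bar>k i x - k 1 x\<bar> \<le> int N"
    and bounded: "\<And>x. x \<in> X \<Longrightarrow> B \<le> k 1 x"
    and less: "\<And>x y. \<lbrakk>x \<in> X; y \<in> X; \<forall>i\<in>{1..p}. k i x < k i y\<rbrakk> \<Longrightarrow> (x, y) \<in> R"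
    and cell: "\<And>C. \<lbrakk>C \<subseteq> X; C \<noteq> {}; \<forall>x\<in>C. \<forall>y\<in>C. \<forall>i\<in>{1..p}. k i x = k i y\<rbrakk>
      \<Longrightarrow> \<exists>P. approximation_set R C P \<and> finite P \<and> card P \<le> c"
  shows "\<exists>P. approximation_set R X P \<and> finite P \<and> card P \<le> c * (2 * N + 1) ^ (p - 1)"
proof -
  \<comment> \<open>\<open>D x\<close> names the diagonal through the cell of \<open>x\<close>. The
    difference at index 1 is always 0, so only \<open>p - 1\<close> coordinates remain; this is
    where the exponent drops from \<open>p\<close> to \<open>p - 1\<close>. Restricting to
    \<open>{2..p}\<close> makes \<open>D x\<close> extensional, so it lies in the finite function
    space \<open>T\<close>.\<close>
  define D where "D = (\<lambda>x. \<lambda>i\<in>{2..p}. k i x - k 1 x)"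
  define T where "T = ({2..p} \<rightarrow>\<^sub>E {- int N..int N})"
  have D_T: "D ` X \<subseteq> T"
  proof
    fix d assume "d \<in> D ` X"
    then obtain x where x: "x \<in> X" "d = D x" by blast
    have "- int N \<le> k i x - k 1 x \<and> k i x - k 1 x \<le> int N" if "i \<in> {2..p}" for i
      using width[OF x(1), of i] that by (auto simp: abs_le_iff)
    then show "d \<in> T" using x by (auto simp: D_def T_def)
  qed
  have finT: "finite T" unfolding T_def by (intro finite_PiE) auto
  have cardT: "card T = (2 * N + 1) ^ (p - 1)"
  proof -
    have "nat (int N + 1 + int N) = 2 * N + 1" by simp
    then show ?thesis unfolding T_def by (simp add: card_PiE)
  qed
  have fin: "finite (D ` X)" using D_T finT finite_subset by blast
  have cardD: "card (D ` X) \<le> (2 * N + 1) ^ (p - 1)"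
    using card_mono[OF finT D_T] cardT by simp
  have "\<exists>P. P \<subseteq> X \<and> finite P \<and> card P \<le> c \<and> (\<forall>y\<in>X. D y = d \<longrightarrow> (\<exists>x\<in>P. (x, y) \<in> R))"
    if d: "d \<in> D ` X" for d
  proof -
    \<comment> \<open>\<open>X\<close> may be infinite, so a first cell needs an argument:
      subtracting the lower bound \<open>B\<close> turns \<open>k 1\<close> into a natural number
      without losing order, and that has a minimum on the diagonal.\<close>
    obtain x0 where x0: "x0 \<in> X" "D x0 = d"
      and least: "\<And>y. y \<in> X \<Longrightarrow> D y = d \<Longrightarrow> nat (k 1 x0 - B) \<le> nat (k 1 y - B)"
      using d ex_has_least_nat[of "\<lambda>x. x \<in> X \<and> D x = d" _ "\<lambda>x. nat (k 1 x - B)"] by blast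
    have first: "k 1 x0 \<le> k 1 y" if "y \<in> X" "D y = d" for y
      using least[OF that] bounded[OF that(1)] bounded[OF x0(1)] by simp
    have diag: "k i x - k 1 x = k i y - k 1 y" if "D x = d" "D y = d" "i \<in> {1..p}" for x y i
    proof (cases "i = 1")
      case False
      with that have "i \<in> {2..p}" by auto
      moreover have "D x i = D y i" using that by simp
      ultimately show ?thesis by (simp add: D_def)
    qed simp
    \<comment> \<open>On a fixed diagonal the coordinate \<open>k 1\<close> determines all others,
      so this is exactly the first nonempty cell.\<close>
    define C where "C = {x \<in> X. D x = d \<and> k 1 x = k 1 x0}"
    have x0C: "x0 \<in> C" using x0 by (simp add: C_def)
    have "C \<subseteq> X" "C \<noteq> {}" using x0C by (auto simp: C_def)
    moreover have "\<forall>x\<in>C. \<forall>y\<in>C. \<forall>i\<in>{1..p}. k i x = k i y"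
    proof (intro ballI)
      fix x y i assume "x \<in> C" "y \<in> C" "i \<in> {1..p}"
      then show "k i x = k i y" using diag[of x y i] by (simp add: C_def)
    qed
    ultimately obtain P where P: "approximation_set R C P" "finite P" "card P \<le> c"
      using cell by blast
    \<comment> \<open>One arbitrary point of the first cell serves all later cells of the
      diagonal.\<close>
    obtain z where z: "z \<in> P" using P(1) x0C by (auto simp: approximation_set_def)
    have PC: "P \<subseteq> C" using P(1) by (simp add: approximation_set_def)
    have "\<exists>x\<in>P. (x, y) \<in> R" if y: "y \<in> X" "D y = d" for y
    proof (cases "k 1 y = k 1 x0")
      case True
      then have "y \<in> C" using y by (simp add: C_def)
      then show ?thesis using P(1) by (simp add: approximation_set_def)
    next
      case False
      have zC: "z \<in> X" "D z = d" "k 1 z = k 1 x0" using z PC by (auto simp: C_def)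
      have lt: "k 1 z < k 1 y" using False first[OF y] zC(3) by simp
      \<comment> \<open>Along a diagonal all coordinates shift by the same amount, so the strict gap
        at index 1 carries over to every index.\<close>
      have "\<forall>i\<in>{1..p}. k i z < k i y"
      proof
        fix i assume "i \<in> {1..p}"
        from diag[OF zC(2) y(2) this] lt show "k i z < k i y" by simp
      qed
      then show ?thesis using less[OF zC(1) y(1)] z by blast
    qed
    moreover have "P \<subseteq> X" using PC by (auto simp: C_def)
    ultimately show ?thesis using P by blast
  qed
  then obtain Q where Q: "\<And>d. d \<in> D ` X \<Longrightarrow> Q d \<subseteq> X \<and> finite (Q d) \<and> card (Q d) \<le> c \<and>
      (\<forall>y\<in>X. D y = d \<longrightarrow> (\<exists>x\<in>Q d. (x, y) \<in> R))"
    by metis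
  define P where "P = (\<Union>d\<in>D ` X. Q d)"
  have "approximation_set R X P"
    unfolding approximation_set_def P_def
  proof (intro conjI ballI)
    show "(\<Union>d\<in>D ` X. Q d) \<subseteq> X" using Q by blast
    fix y assume "y \<in> X"
    then show "\<exists>x\<in>\<Union>d\<in>D ` X. Q d. (x, y) \<in> R" using Q[of "D y"] by blast
  qed
  moreover have "finite P" unfolding P_def using fin Q by blast
  moreover have "card P \<le> c * (2 * N + 1) ^ (p - 1)"
  proof -
    have "card P \<le> (\<Sum>d\<in>D ` X. card (Q d))"
      unfolding P_def using fin by (rule card_UN_le)
    also have "\<dots> \<le> (\<Sum>d\<in>D ` X. c)" using Q by (intro sum_mono) blast
    also have "\<dots> = c * card (D ` X)" by simp
    also have "\<dots> \<le> c * (2 * N + 1) ^ (p - 1)" using cardD by (rule mult_le_mono2)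
    finally show ?thesis .
  qed
  ultimately show ?thesis by blast
qed

section \<open>Encoding lengths and logarithms of objective values\<close>

lemma less_two_power_nat_bitlen:
  assumes "x > 0"
  shows "x < 2 ^ nat (bitlen x)"
  using bitlen_bounds[OF assms] by simp

lemma rat_encoding_length_pos:
  "rat_encoding_length q > 0"
proof -
  have "bitlen (snd (quotient_of q)) > 0"
    using quotient_of_denom_pos'[of q] by (simp add: bitlen_def floorlog_eq_zero_iff flip: neq0_conv)
  then show ?thesis unfolding rat_encoding_length_def by simp
qed

text \<open>Numerator and denominator are integers between 1 and \<open>2 ^ n\<close>, with
  \<open>n\<close> the encoding length. Both logarithms thus lie between 0 and \<open>n\<close>, and
  so their difference is at most \<open>n\<close> in absolute value.\<close>

lemma abs_log2_le_rat_encoding_length: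
  assumes "q > 0"
  shows "\<bar>log 2 (real_of_rat q)\<bar> \<le> real (rat_encoding_length q)"
proof -
  obtain a b where ab: "quotient_of q = (a, b)" by fastforce
  have b: "b > 0" using quotient_of_denom_pos[OF ab] .
  have q: "q = of_int a / of_int b" using quotient_of_div[OF ab] .
  have a: "a > 0" using assms b unfolding q by (simp add: zero_less_divide_iff)
  let ?n = "rat_encoding_length q"
  have "a < 2 ^ nat (bitlen a)" "b < 2 ^ nat (bitlen b)"
    using less_two_power_nat_bitlen a b by blast+
  moreover have "(2::int) ^ nat (bitlen a) \<le> 2 ^ ?n" "(2::int) ^ nat (bitlen b) \<le> 2 ^ ?n"
    using a ab by (simp_all add: rat_encoding_length_def)
  ultimately have "a \<le> 2 ^ ?n" "b \<le> 2 ^ ?n" by linarith+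
  then have "real_of_int a \<le> 2 ^ ?n" "real_of_int b \<le> 2 ^ ?n"
    by (metis of_int_le_iff of_int_numeral of_int_power)+
  then have "log 2 a \<le> ?n" "log 2 b \<le> ?n" using a b
    by (simp_all add: log_le_iff powr_realpow)
  moreover have "log 2 a \<ge> 0" "log 2 b \<ge> 0" using a b by simp_all
  moreover have "log 2 (real_of_rat q) = log 2 a - log 2 b"
    using a b unfolding q by (simp add: of_rat_divide log_divide)
  ultimately show ?thesis by linarith
qed

text \<open>Changing the base from 2 to \<open>1 + \<epsilon>\<close> costs at most the factor
  \<open>(1 + \<epsilon>) / \<epsilon>\<close>, since \<open>ln 2 \<le> 1\<close> and
  \<open>ln (1 + \<epsilon>) \<ge> \<epsilon> / (1 + \<epsilon>)\<close>. The latter is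
  \<open>ln t \<le> t - 1\<close> at \<open>t = 1 / (1 + \<epsilon>)\<close> and holds for large
  \<epsilon> too.\<close>

lemma log_one_plus_le:
  fixes \<epsilon> y m :: real
  assumes "\<epsilon> > 0" and "\<bar>log 2 y\<bar> \<le> m"
  shows "\<bar>log (1 + \<epsilon>) y\<bar> \<le> m * (1 + \<epsilon>) / \<epsilon>"
proof -
  have "ln (1 + \<epsilon>) \<ge> 1 - 1 / (1 + \<epsilon>)"
    using ln_le_minus_one[of "1 / (1 + \<epsilon>)"] assms(1) by (simp add: ln_div)
  also have "1 - 1 / (1 + \<epsilon>) = \<epsilon> / (1 + \<epsilon>)" using assms(1) by (simp add: field_simps)
  finally have ln: "\<epsilon> / (1 + \<epsilon>) \<le> ln (1 + \<epsilon>)" .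
  have pos: "\<epsilon> / (1 + \<epsilon>) > 0" using assms(1) by simp
  have "ln 2 \<le> (1::real)" using ln_le_minus_one[of "2::real"] by simp
  have "\<bar>ln y\<bar> = \<bar>log 2 y\<bar> * ln 2" by (simp add: log_def abs_divide)
  also have "\<dots> \<le> m * 1" using assms(2) \<open>ln 2 \<le> 1\<close> by (intro mult_mono) auto
  finally have ln_y: "\<bar>ln y\<bar> \<le> m" by simp
  have "\<bar>log (1 + \<epsilon>) y\<bar> = \<bar>ln y\<bar> / ln (1 + \<epsilon>)"
    using assms(1) by (simp add: log_def abs_divide)
  moreover have "\<bar>ln y\<bar> / ln (1 + \<epsilon>) \<le> m / (\<epsilon> / (1 + \<epsilon>))"
    using ln_y ln pos by (intro frac_le) auto
  ultimately show ?thesis by simp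
qed

text \<open>A strictly smaller cell index gives a comparison without the factor \<open>b\<close>, as
  monotonicity of \<open>R'\<close> requires.\<close>

lemma floor_log_less_imp_le:
  fixes b x y :: real
  assumes "b > 1" "x > 0" "y > 0" "\<lfloor>log b x\<rfloor> < \<lfloor>log b y\<rfloor>"
  shows "x \<le> y"
proof -
  have "log b x \<le> log b y" using assms(4) by linarith
  then show ?thesis using assms by simp
qed

lemma floor_log_eq_imp_le:
  fixes b x y :: real
  assumes "b > 1" "x > 0" "y > 0" "\<lfloor>log b x\<rfloor> = \<lfloor>log b y\<rfloor>"
  shows "x \<le> b * y"
proof -
  have "log b x \<le> 1 + log b y" using assms(4) by linarith
  also have "\<dots> = log b (b * y)" using assms by (simp add: log_mult)
  finally show ?thesis using assms by simp
qed

text \<open>On the range up to \<open>E\<close> the factor \<open>1 + \<epsilon>\<close> is at most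
  \<open>1 + E\<close>, so it is absorbed into a constant depending on \<open>E\<close>.\<close>

lemma scaled_power_in_O_M_over_eps:
  fixes a b :: real
  assumes "a \<ge> 0" "b \<ge> 0"
  shows "(\<lambda>(m, \<epsilon>). a * (b * real m * (1 + \<epsilon>) / \<epsilon>) ^ k) \<in> O_M_over_eps k"
  unfolding O_M_over_eps_def
proof (intro INT_I bigoI)
  fix E :: real assume E: "E \<in> {0<..}"
  have "norm (a * (b * real m * (1 + \<epsilon>) / \<epsilon>) ^ k)
      \<le> a * (b * (1 + E)) ^ k * norm ((real m / \<epsilon>) ^ k)"
    if "\<epsilon> \<in> {0<..E}" for m :: nat and \<epsilon>
  proof -
    have "b * real m * (1 + \<epsilon>) / \<epsilon> = b * (1 + \<epsilon>) * (real m / \<epsilon>)" by simp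
    also have "\<dots> \<le> b * (1 + E) * (real m / \<epsilon>)"
      using that assms by (intro mult_right_mono mult_left_mono) auto
    finally have "(b * real m * (1 + \<epsilon>) / \<epsilon>) ^ k \<le> (b * (1 + E) * (real m / \<epsilon>)) ^ k"
      using that assms by (intro power_mono) auto
    from mult_left_mono[OF this assms(1)]
    have "a * (b * real m * (1 + \<epsilon>) / \<epsilon>) ^ k \<le> a * (b * (1 + E)) ^ k * (real m / \<epsilon>) ^ k"
      by (simp only: power_mult_distrib mult.assoc)
    moreover have "norm (a * (b * real m * (1 + \<epsilon>) / \<epsilon>) ^ k) = a * (b * real m * (1 + \<epsilon>) / \<epsilon>) ^ k"
      "norm ((real m / \<epsilon>) ^ k) = (real m / \<epsilon>) ^ k"
      using that assms by simp_all
    ultimately show ?thesis by simp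
  qed
  then show "\<forall>\<^sub>F x in principal (UNIV \<times> {0<..E}).
      norm (case x of (m, \<epsilon>) \<Rightarrow> a * (b * real m * (1 + \<epsilon>) / \<epsilon>) ^ k)
      \<le> a * (b * (1 + E)) ^ k * norm (case x of (m, \<epsilon>) \<Rightarrow> (real m / \<epsilon>) ^ k)"
    by (auto simp: eventually_principal)
qed

section \<open>The logarithmic grid of a single instance\<close>

context multiobjective_problem
begin

lemma eps_approximation_set:
  fixes R' R :: "('x \<times> 'x) set" and \<epsilon> :: real
  assumes I: "I \<in> Inst" and eps: "\<epsilon> > 0"
    and mono: "monotonic_relation p (X I) (f I) R'"
    and R: "R = {(x, x') \<in> X I \<times> X I. eps_dominates p (f I) \<epsilon> x x' \<and> (x, x') \<in> R'}"
    and dom: "\<And>X'. \<lbrakk>X' \<subseteq> X I; X' \<noteq> {}\<rbrakk>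
      \<Longrightarrow> \<exists>P. dominating_set R' X' P \<and> finite P \<and> card P \<le> c"
  shows "\<exists>P. approximation_set R (X I) P \<and> finite P \<and>
    real (card P) \<le> real c * (9 * real (M I) * (1 + \<epsilon>) / \<epsilon>) ^ (p - 1)"
proof (cases "X I = {}")
  case True
  then show ?thesis using eps by (intro exI[of _ "{}"]) (simp add: approximation_set_def)
next
  case False
  define A where "A = real (M I) * (1 + \<epsilon>) / \<epsilon>"
  define k where "k = (\<lambda>i x. \<lfloor>log (1 + \<epsilon>) (real_of_rat (f I i x))\<rfloor>)"
  \<comment> \<open>Two reals in \<open>[-A, A]\<close> have floors that differ by less than
    \<open>2 * A + 1\<close>.\<close>
  define N where "N = nat \<lfloor>2 * A + 1\<rfloor>"
  have one: "1 \<in> {1..p}" using p_pos by simp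
  from False obtain x where x: "x \<in> X I" by blast
  \<comment> \<open>A denominator has at least one bit, so a feasible point forces
    \<open>M I\<close> to be positive; hence the separate treatment of an empty \<open>X I\<close>.
    The resulting \<open>A \<ge> 1\<close> later absorbs additive constants.\<close>
  have "M I \<ge> 1"
    using objective_length[OF I one x] rat_encoding_length_pos[of "f I 1 x"] by linarith
  then have "A \<ge> 1"
    using eps mult_mono[of 1 "real (M I)" \<epsilon> "1 + \<epsilon>"] by (simp add: A_def)
  have log_le: "\<bar>log (1 + \<epsilon>) (real_of_rat (f I i x))\<bar> \<le> A" if "x \<in> X I" "i \<in> {1..p}" for i x
    unfolding A_def using eps
  proof (rule log_one_plus_le)
    show "\<bar>log 2 (real_of_rat (f I i x))\<bar> \<le> real (M I)"
      using abs_log2_le_rat_encoding_length[OF objective_pos[OF I that(2,1)]]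
        objective_length[OF I that(2,1)] by linarith
  qed
  have pos: "real_of_rat (f I i x) > 0" if "x \<in> X I" "i \<in> {1..p}" for i x
    using objective_pos[OF I that(2,1)] by simp
  have R'_I: "(x, y) \<in> R'" if "x \<in> X I" "y \<in> X I" "\<forall>i\<in>{1..p}. f I i x \<le> f I i y" for x y
    using mono that by (simp add: monotonic_relation_def)
  have "\<exists>P. approximation_set R (X I) P \<and> finite P \<and> card P \<le> c * (2 * N + 1) ^ (p - 1)"
  proof (rule diagonal_approximation_set[OF p_pos, of "X I" k N "\<lfloor>- A\<rfloor>"])
    show "\<bar>k i x - k 1 x\<bar> \<le> int N" if "x \<in> X I" "i \<in> {1..p}" for x i
      using log_le[OF that] log_le[OF that(1) one] \<open>A \<ge> 1\<close> unfolding k_def N_def by linarith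
    show "\<lfloor>- A\<rfloor> \<le> k 1 x" if "x \<in> X I" for x
      using log_le[OF that one] unfolding k_def by (intro floor_mono) linarith
  next
    fix x y assume xy: "x \<in> X I" "y \<in> X I" "\<forall>i\<in>{1..p}. k i x < k i y"
    have le: "f I i x \<le> f I i y" if "i \<in> {1..p}" for i
      using floor_log_less_imp_le[OF _ pos[OF xy(1) that] pos[OF xy(2) that], of "1 + \<epsilon>"]
        xy(3) that eps by (simp add: k_def of_rat_less_eq)
    have "real_of_rat (f I i x) \<le> (1 + \<epsilon>) * real_of_rat (f I i y)" if "i \<in> {1..p}" for i
    proof -
      have "real_of_rat (f I i x) \<le> 1 * real_of_rat (f I i y)"
        using le[OF that] by (simp add: of_rat_less_eq)
      also have "\<dots> \<le> (1 + \<epsilon>) * real_of_rat (f I i y)"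
        using eps pos[OF xy(2) that] by (intro mult_right_mono) auto
      finally show ?thesis .
    qed
    then show "(x, y) \<in> R" using xy R'_I le by (simp add: R eps_dominates_def)
  next
    fix C assume C: "C \<subseteq> X I" "C \<noteq> {}" "\<forall>x\<in>C. \<forall>y\<in>C. \<forall>i\<in>{1..p}. k i x = k i y"
    from dom[OF C(1,2)] obtain P where P: "dominating_set R' C P" "finite P" "card P \<le> c"
      by blast
    have PC: "P \<subseteq> C" using P(1) by (simp add: dominating_set_def)
    have eps_dom: "eps_dominates p (f I) \<epsilon> x y" if "x \<in> C" "y \<in> C" for x y
      unfolding eps_dominates_def
    proof
      fix i assume i: "i \<in> {1..p}"
      have "x \<in> X I" "y \<in> X I" using that C(1) by auto
      then show "real_of_rat (f I i x) \<le> (1 + \<epsilon>) * real_of_rat (f I i y)"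
        using floor_log_eq_imp_le[OF _ pos[OF _ i] pos[OF _ i], of "1 + \<epsilon>" x y]
          C(3)[rule_format, OF that i] eps by (simp add: k_def)
    qed
    have "\<exists>x\<in>P. (x, y) \<in> R" if y: "y \<in> C" for y
    proof -
      \<comment> \<open>A dominating set only covers the points outside it, whereas an approximation
        set must also cover its own. Monotonicity makes \<open>R'\<close> reflexive on
        \<open>X I\<close>, which closes the gap.\<close>
      obtain x where x: "x \<in> P" "(x, y) \<in> R'"
      proof (cases "y \<in> P")
        case True
        then show ?thesis using that[of y] R'_I[of y y] y C(1) by blast
      next
        case False
        then show ?thesis using that P(1) y by (auto simp: dominating_set_def)
      qed
      then have "x \<in> C" using PC by blast
      then have "(x, y) \<in> R" using C(1) y eps_dom x by (simp add: R subset_iff)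
      then show ?thesis using x by blast
    qed
    then show "\<exists>P. approximation_set R C P \<and> finite P \<and> card P \<le> c"
      using P PC by (auto simp: approximation_set_def)
  qed
  then obtain P where P: "approximation_set R (X I) P" "finite P"
      "card P \<le> c * (2 * N + 1) ^ (p - 1)"
    by blast
  have "real N \<le> 2 * A + 1" using \<open>A \<ge> 1\<close> unfolding N_def by linarith
  \<comment> \<open>The left side is at most \<open>4 * A + 3\<close>, and \<open>A \<ge> 1\<close>
    leaves room to spare.\<close>
  then have "real (2 * N + 1) \<le> 9 * A" using \<open>A \<ge> 1\<close> by simp
  then have "real (2 * N + 1) ^ (p - 1) \<le> (9 * A) ^ (p - 1)" by (intro power_mono) auto
  then have "real c * real (2 * N + 1) ^ (p - 1) \<le> real c * (9 * A) ^ (p - 1)"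
    by (intro mult_left_mono) auto
  moreover have "real (card P) \<le> real c * real (2 * N + 1) ^ (p - 1)"
    using P(3) by (metis of_nat_le_iff of_nat_mult of_nat_power)
  ultimately have "real (card P) \<le> real c * (9 * A) ^ (p - 1)" by linarith
  then show ?thesis using P by (auto simp: A_def mult.assoc)
qed

end

theorem theorem3p1:
  fixes p c :: nat
    and Inst :: "'i set"
    and len :: "'i \<Rightarrow> nat"
    and X :: "'i \<Rightarrow> 'x set"
    and f :: "'i \<Rightarrow> nat \<Rightarrow> 'x \<Rightarrow> rat"
    and M :: "'i \<Rightarrow> nat"
  assumes "multiobjective_problem p Inst len X f M"
  shows "\<exists>g \<in> O_M_over_eps (p - 1).
    \<forall>I\<in>Inst. \<forall>\<epsilon>>0. \<forall>R' R :: ('x \<times> 'x) set.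
      monotonic_relation p (X I) (f I) R' \<longrightarrow>
      R = {(x, x') \<in> X I \<times> X I. eps_dominates p (f I) \<epsilon> x x' \<and> (x, x') \<in> R'} \<longrightarrow>
      (\<forall>X'. X' \<subseteq> X I \<and> X' \<noteq> {} \<longrightarrow>
        (\<exists>P. dominating_set R' X' P \<and> finite P \<and> card P \<le> c)) \<longrightarrow>
      (\<exists>P. approximation_set R (X I) P \<and> finite P \<and> real (card P) \<le> g (M I, \<epsilon>))"
proof -
  interpret multiobjective_problem p Inst len X f M by fact
  show ?thesis
  \<comment> \<open>The witness depends only on \<open>c\<close> and \<open>p\<close> and is fixed
    before the instance, \<epsilon> and the relations are introduced.\<close>
  proof (intro bexI[OF _ scaled_power_in_O_M_over_eps[of "real c" 9]] ballI allI impI)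
    fix I \<epsilon> and R' R :: "('x \<times> 'x) set"
    assume "I \<in> Inst" "\<epsilon> > 0" "monotonic_relation p (X I) (f I) R'"
      "R = {(x, x') \<in> X I \<times> X I. eps_dominates p (f I) \<epsilon> x x' \<and> (x, x') \<in> R'}"
      and dom: "\<forall>X'. X' \<subseteq> X I \<and> X' \<noteq> {} \<longrightarrow>
        (\<exists>P. dominating_set R' X' P \<and> finite P \<and> card P \<le> c)"
    from eps_approximation_set[OF this(1-4)] dom
    show "\<exists>P. approximation_set R (X I) P \<and> finite P \<and> real (card P)
        \<le> (case (M I, \<epsilon>) of (m, \<epsilon>) \<Rightarrow> real c * (9 * real m * (1 + \<epsilon>) / \<epsilon>) ^ (p - 1))"
      unfolding prod.case by blast
  qed simp_all
qed

end
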